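(* Let $J$ be the Jacobi matrix of Example 4.1 (described in the context) and $\rho$ its spectral measure. Then for Lebesgue almost every $x_0\in[-2,2]\setminus[-1,1]$, $\rho$ fails the Nevai condition at $x_0$.
   Context: Example 4.1: partition $\{1,2,\dots\}$ into successive consecutive blocks $A_1,C_1,A_2,C_2,\dots$ (in this order) with $\#A_j=3^{j^2}$ and $\#C_j=2^{j^2}$. Let $J$ be the half-line Jacobi matrix on $\ell^2(\{1,2,\dots\})$ with $J_{nn}=b_n=0$, $J_{n,n+1}=J_{n+1,n}=a_n$, where $a_n=1$ for $n\in A_j$ and $a_n=\tfrac12$ for $n\in C_j$. Then $\sigma(J)=[-2,2]$ and $(a_1\cdots a_n)^{1/n}\to1$. Let $\rho$ be the spectral measure of $J$ and $\delta_1$, $p_n$ its orthonormal polynomials ($p_0=1$, so that $xp_n=a_{n+1}p_{n+1}+b_{n+1}p_n+a_np_{n-1}$, $p_{-1}=0$), $K_n(x,y)=\sum_{j=0}^np_j(x)p_j(y)$. The Nevai condition at $x_0$ means $K_n(x,x_0)^2\,d\rho(x)/K_n(x_0,x_0)\to\delta_{x_0}$ weakly as $n\to\infty$. *)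

theory Defs
  imports "HOL-Analysis.Analysis"
begin

text \<open>Example 4.1. Sites are indexed by 1,2,3,...  The blocks come in the order
A_1, C_1, A_2, C_2, ... with card A_j = 3^(j^2), card C_j = 2^(j^2).
ex41_start j is the number of sites preceding block A_j.\<close>

definition ex41_start :: "nat \<Rightarrow> nat" where
  "ex41_start j = (\<Sum>i\<in>{1..<j}. 3 ^ (i^2) + 2 ^ (i^2))"

definition ex41_inA :: "nat \<Rightarrow> bool" where
  "ex41_inA n \<longleftrightarrow> (\<exists>j\<ge>1. ex41_start j < n \<and> n \<le> ex41_start j + 3 ^ (j^2))"

text \<open>Off-diagonal Jacobi parameters a_n (n \<ge> 1): 1 on the A-blocks, 1/2 on the C-blocks.
(The value at n = 0 is never used.) The diagonal b_n is 0.\<close>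
definition ex41_a :: "nat \<Rightarrow> real" where
  "ex41_a n = (if ex41_inA n then 1 else 1/2)"

text \<open>Action of the Jacobi matrix J on vectors indexed by 1,2,... (entry 0 is kept 0):
(J v)_n = a_{n-1} v_{n-1} + b_n v_n + a_n v_{n+1}, with b_n = 0 and v_0 = 0.\<close>
definition ex41_J :: "(nat \<Rightarrow> real) \<Rightarrow> nat \<Rightarrow> real" where
  "ex41_J v n = (if n = 0 then 0
      else (if n \<ge> 2 then ex41_a (n - 1) * v (n - 1) else 0) + ex41_a n * v (n + 1))"

definition delta1 :: "nat \<Rightarrow> real" where
  "delta1 n = (if n = 1 then 1 else 0)"

definition ex41_moment :: "nat \<Rightarrow> real" where
  "ex41_moment k = (ex41_J ^^ k) delta1 1"

text \<open>rho is the spectral measure of J and delta_1: the Borel measure on the real line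
with integral of x^k equal to <delta_1, J^k delta_1> for every k (J is bounded, so this
determines the measure uniquely).\<close>
definition is_spectral_measure_ex41 :: "real measure \<Rightarrow> bool" where
  "is_spectral_measure_ex41 \<rho> \<longleftrightarrow> sets \<rho> = sets borel \<and>
     (\<forall>k. integrable \<rho> (\<lambda>x. x ^ k) \<and> (\<integral>x. x ^ k \<partial>\<rho>) = ex41_moment k)"

text \<open>Orthonormal polynomials: p_0 = 1, p_{-1} = 0,
x p_n = a_{n+1} p_{n+1} + b_{n+1} p_n + a_n p_{n-1}, b = 0.\<close>
fun ex41_p :: "nat \<Rightarrow> real \<Rightarrow> real" where
  "ex41_p 0 x = 1"
| "ex41_p (Suc 0) x = x / ex41_a 1"
| "ex41_p (Suc (Suc n)) x =
     (x * ex41_p (Suc n) x - ex41_a (Suc n) * ex41_p n x) / ex41_a (Suc (Suc n))"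

definition ex41_K :: "nat \<Rightarrow> real \<Rightarrow> real \<Rightarrow> real" where
  "ex41_K n x y = (\<Sum>j\<le>n. ex41_p j x * ex41_p j y)"

text \<open>Nevai condition at x0: the measures K_n(x,x0)^2 d rho(x) / K_n(x0,x0) converge weakly
to the point mass at x0, i.e. integrals of every bounded continuous function converge.\<close>
definition nevai_at :: "real measure \<Rightarrow> real \<Rightarrow> bool" where
  "nevai_at \<rho> x0 \<longleftrightarrow>
     (\<forall>f :: real \<Rightarrow> real. continuous_on UNIV f \<and> bounded (range f) \<longrightarrow>
        (\<lambda>n. (\<integral>x. f x * (ex41_K n x x0)\<^sup>2 \<partial>\<rho>) / ex41_K n x0 x0) \<longlonglongrightarrow> f x0)"

end

theory Submission
  imports Defs "HOL-Computational_Algebra.Polynomial" "HOL-Real_Asymp.Real_Asymp"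
begin

text \<open>
  By the Christoffel--Darboux formula and orthonormality, the second moment about \<open>x\<^sub>0\<close> of
  \<open>K\<^sub>n(x, x\<^sub>0)\<^sup>2 d\<rho>(x)\<close> is \<open>a\<^sub>n\<^sub>+\<^sub>1\<^sup>2 (p\<^sub>n(x\<^sub>0)\<^sup>2 + p\<^sub>n\<^sub>+\<^sub>1(x\<^sub>0)\<^sup>2)\<close>.  Since \<open>\<rho>\<close> has bounded
  support, the Nevai condition at \<open>x\<^sub>0\<close> forces \<open>p\<^sub>n\<^sup>2 / K\<^sub>n \<longlongrightarrow> 0\<close> there, so \<open>K\<^sub>n\<close> grows
  subexponentially.

  On a block \<open>C\<^sub>j\<close> of length \<open>L = 2\<^bsup>j\<^sup>2\<^esup>\<close> beginning after site \<open>M\<close> the recurrence is hyperbolic for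
  \<open>x\<^sub>0 > 1\<close>; the component of \<open>(p\<^sub>M, p\<^sub>M\<^sub>+\<^sub>1)\<close> off the contracting direction is multiplied by an
  exponentially large factor, hence it must be exponentially small in \<open>L\<close> relative to
  \<open>sqrt K\<^sub>M\<close>.  The derivative form of Christoffel--Darboux makes the direction of
  \<open>(p\<^sub>M, p\<^sub>M\<^sub>+\<^sub>1)\<close> turn monotonically past the contracting direction as \<open>x\<^sub>0\<close> varies, and it
  does so at most \<open>M + 1\<close> times because \<open>p\<^sub>M\<close> has at most \<open>M\<close> zeros.  So the exceptional set of
  block \<open>j\<close> has measure at most \<open>O(M)\<close> times a quantity exponentially small in \<open>L\<close>; as \<open>M\<close> is
  polynomially bounded in \<open>L\<close>, this tends to zero, and a point satisfying the Nevai condition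
  lies in all but finitely many exceptional sets.  Negative \<open>x\<^sub>0\<close> are covered by the symmetry
  \<open>p\<^sub>n(-x) = (-1)\<^sup>n p\<^sub>n(x)\<close>.
\<close>

section \<open>The recurrence and the Christoffel-Darboux formula\<close>

lemma ex41_a_ge: "1/2 \<le> ex41_a n" and ex41_a_le: "ex41_a n \<le> 1"
  by (auto simp: ex41_a_def)

lemma ex41_a_pos: "ex41_a n > 0"
  by (auto simp: ex41_a_def)

lemma ex41_a_nz [simp]: "ex41_a n \<noteq> 0"
  by (auto simp: ex41_a_def)

lemma ex41_p_rec:
  "ex41_a (Suc (Suc n)) * ex41_p (Suc (Suc n)) x = x * ex41_p (Suc n) x - ex41_a (Suc n) * ex41_p n x"
  by simp

lemma ex41_p_rec0: "ex41_a (Suc 0) * ex41_p (Suc 0) x = x"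
  by simp

declare ex41_p.simps(2,3) [simp del]

lemma ex41_K_Suc: "ex41_K (Suc n) x y = ex41_K n x y + ex41_p (Suc n) x * ex41_p (Suc n) y"
  by (simp add: ex41_K_def)

text \<open>Telescoping: applying the recurrence in both variables to the right-hand side at
  \<open>Suc n\<close> yields the new summand plus the right-hand side at \<open>n\<close>.\<close>

lemma christoffel_darboux:
  "(x - y) * ex41_K n x y =
     ex41_a (Suc n) * (ex41_p (Suc n) x * ex41_p n y - ex41_p n x * ex41_p (Suc n) y)"
proof (induction n)
  case 0
  have "ex41_a (Suc 0) * (ex41_p (Suc 0) x * ex41_p 0 y - ex41_p 0 x * ex41_p (Suc 0) y) =
     ex41_a (Suc 0) * ex41_p (Suc 0) x - ex41_a (Suc 0) * ex41_p (Suc 0) y"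
    by (simp add: algebra_simps)
  then show ?case
    by (simp add: ex41_K_def ex41_p_rec0)
next
  case (Suc n)
  have "ex41_a (Suc (Suc n)) * (ex41_p (Suc (Suc n)) x * ex41_p (Suc n) y
          - ex41_p (Suc n) x * ex41_p (Suc (Suc n)) y)
      = (ex41_a (Suc (Suc n)) * ex41_p (Suc (Suc n)) x) * ex41_p (Suc n) y
          - ex41_p (Suc n) x * (ex41_a (Suc (Suc n)) * ex41_p (Suc (Suc n)) y)"
    by (simp add: algebra_simps)
  also have "\<dots> = (x - y) * ex41_p (Suc n) x * ex41_p (Suc n) y + (x - y) * ex41_K n x y"
    unfolding ex41_p_rec Suc by (simp add: algebra_simps)
  finally show ?case
    by (simp add: ex41_K_Suc algebra_simps)
qed

section \<open>Zeros, derivatives, positivity of the kernel and parity\<close>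

text \<open>The recurrence of \<open>ex41_p\<close> repeated in \<open>real poly\<close>, which
  gives access to degrees, root counting and \<open>pderiv\<close>.\<close>

fun ex41_poly :: "nat \<Rightarrow> real poly" where
  "ex41_poly 0 = 1"
| "ex41_poly (Suc 0) = smult (1 / ex41_a (Suc 0)) [:0, 1:]"
| "ex41_poly (Suc (Suc n)) = smult (1 / ex41_a (Suc (Suc n)))
     (pCons 0 (ex41_poly (Suc n)) - smult (ex41_a (Suc n)) (ex41_poly n))"

lemma poly_ex41_poly: "poly (ex41_poly n) x = ex41_p n x"
  by (induction n rule: ex41_poly.induct) (auto simp: ex41_p.simps field_simps)

lemma ex41_poly_degree: "degree (ex41_poly n) \<le> n \<and> coeff (ex41_poly n) n \<noteq> 0"
proof (induction n rule: ex41_poly.induct)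
  case (3 n)
  have "degree (pCons 0 (ex41_poly (Suc n)) - smult (ex41_a (Suc n)) (ex41_poly n)) \<le> Suc (Suc n)"
    using 3 by (intro degree_diff_le) (auto intro: order_trans[OF degree_pCons_le])
  moreover have "coeff (ex41_poly n) (Suc (Suc n)) = 0"
    using 3 by (intro coeff_eq_0) auto
  ultimately show ?case using 3
    by (auto intro: order_trans[OF degree_smult_le])
qed auto

lemma ex41_p_roots:
  "finite {x. ex41_p n x = 0}" "card {x. ex41_p n x = 0} \<le> n"
proof -
  have nz: "ex41_poly n \<noteq> 0"
    using ex41_poly_degree[of n] by auto
  show "finite {x. ex41_p n x = 0}"
    using poly_roots_finite[OF nz] by (simp add: poly_ex41_poly)
  show "card {x. ex41_p n x = 0} \<le> n"
    using card_poly_roots_bound[OF nz] ex41_poly_degree[of n] by (simp add: poly_ex41_poly)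
qed

definition ex41_p' :: "nat \<Rightarrow> real \<Rightarrow> real" where
  "ex41_p' n x = poly (pderiv (ex41_poly n)) x"

lemma ex41_p_deriv [derivative_intros]:
  assumes "(f has_real_derivative f') (at x within S)"
  shows "((\<lambda>x. ex41_p n (f x)) has_real_derivative ex41_p' n (f x) * f') (at x within S)"
proof -
  have "(ex41_p n has_real_derivative ex41_p' n (f x)) (at (f x))"
    using poly_DERIV[of "ex41_poly n" "f x"] by (simp add: poly_ex41_poly ex41_p'_def)
  from DERIV_chain2[OF this assms] show ?thesis .
qed

lemma continuous_ex41_p [continuous_intros]:
  "continuous_on S f \<Longrightarrow> continuous_on S (\<lambda>x. ex41_p n (f x))"
  unfolding poly_ex41_poly[symmetric] by (intro continuous_intros)

lemma continuous_ex41_p' [continuous_intros]: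
  "continuous_on S f \<Longrightarrow> continuous_on S (\<lambda>x. ex41_p' n (f x))"
  unfolding ex41_p'_def by (intro continuous_intros)

lemma ex41_p'_rec:
  "ex41_a (Suc (Suc n)) * ex41_p' (Suc (Suc n)) x =
     ex41_p (Suc n) x + x * ex41_p' (Suc n) x - ex41_a (Suc n) * ex41_p' n x"
  by (simp add: ex41_p'_def pderiv_smult pderiv_diff pderiv_pCons poly_ex41_poly)

text \<open>The confluent case y -> x of \<open>christoffel_darboux\<close>, proved from the
  differentiated recurrence. Positivity of the right-hand side later fixes the sense of
  rotation.\<close>

lemma wronskian:
  "ex41_a (Suc n) * (ex41_p' (Suc n) x * ex41_p n x - ex41_p (Suc n) x * ex41_p' n x) = ex41_K n x x"
proof (induction n)
  case 0
  then show ?case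
    by (simp add: ex41_K_def ex41_p'_def pderiv_smult pderiv_pCons)
next
  case (Suc n)
  have "ex41_a (Suc (Suc n)) * (ex41_p' (Suc (Suc n)) x * ex41_p (Suc n) x
          - ex41_p (Suc (Suc n)) x * ex41_p' (Suc n) x)
      = (ex41_a (Suc (Suc n)) * ex41_p' (Suc (Suc n)) x) * ex41_p (Suc n) x
          - (ex41_a (Suc (Suc n)) * ex41_p (Suc (Suc n)) x) * ex41_p' (Suc n) x"
    by (simp add: algebra_simps)
  also have "\<dots> = ex41_p (Suc n) x * ex41_p (Suc n) x + ex41_K n x x"
    unfolding ex41_p_rec ex41_p'_rec Suc[symmetric] by (simp add: algebra_simps)
  finally show ?case
    by (simp add: ex41_K_Suc)
qed

lemma ex41_K_ge_1: "ex41_K n x x \<ge> 1"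
  by (induction n) (auto simp: ex41_K_Suc intro: order_trans simp: ex41_K_def)

lemma ex41_K_pos: "ex41_K n x x > 0"
  using ex41_K_ge_1[of n x] by linarith

lemma ex41_p_sq_le_K: "(ex41_p n x)\<^sup>2 \<le> ex41_K n x x"
  by (cases n) (use ex41_K_pos[of "n - 1" x] in
    \<open>auto simp: ex41_K_Suc power2_eq_square intro: less_imp_le simp: ex41_K_def\<close>)

text \<open>Holds because the diagonal of J vanishes.\<close>

lemma ex41_p_minus: "ex41_p n (- x) = (-1) ^ n * ex41_p n x"
  by (induction n rule: ex41_poly.induct) (auto simp: ex41_p.simps field_simps)

lemma ex41_p_minus_sq: "(ex41_p n (- x))\<^sup>2 = (ex41_p n x)\<^sup>2"
  by (simp add: ex41_p_minus power_mult_distrib flip: power_mult)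

lemma ex41_K_minus: "ex41_K n (- x) (- x) = ex41_K n x x"
  using ex41_p_minus_sq[of _ x] by (simp add: ex41_K_def power2_eq_square)

section \<open>The Jacobi matrix acting on unit vectors\<close>

definition unit_vec :: "nat \<Rightarrow> nat \<Rightarrow> real" where
  "unit_vec m n = (if n = m then 1 else 0)"

lemma J_unit_vec_1: "ex41_J (unit_vec (Suc 0)) = (\<lambda>n. ex41_a (Suc 0) * unit_vec (Suc (Suc 0)) n)"
  by (rule ext) (auto simp: ex41_J_def unit_vec_def)

lemma J_unit_vec:
  "ex41_J (unit_vec (Suc (Suc m))) =
     (\<lambda>n. ex41_a (Suc m) * unit_vec (Suc m) n + ex41_a (Suc (Suc m)) * unit_vec (Suc (Suc (Suc m))) n)"
  by (rule ext) (auto simp: ex41_J_def unit_vec_def)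

lemma J_linear: "ex41_J (\<lambda>n. c * u n + d * v n) = (\<lambda>n. c * ex41_J u n + d * ex41_J v n)"
  by (auto simp: ex41_J_def algebra_simps)

lemma J_pow_linear:
  "(ex41_J ^^ k) (\<lambda>n. c * u n + d * v n) = (\<lambda>n. c * (ex41_J ^^ k) u n + d * (ex41_J ^^ k) v n)"
  by (induction k) (auto simp: J_linear)

lemma J_pow_scale: "(ex41_J ^^ k) (\<lambda>n. c * u n) = (\<lambda>n. c * (ex41_J ^^ k) u n)"
  using J_pow_linear[of k c u 0 u] by simp

text \<open>Each row of J has at most two nonzero entries, each at most 1, so J at most doubles the
  sup norm.\<close>

lemma abs_J_pow_delta1: "\<bar>(ex41_J ^^ k) delta1 n\<bar> \<le> 2 ^ k"
proof (induction k arbitrary: n)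
  case (Suc k)
  have *: "\<bar>ex41_a i * (ex41_J ^^ k) delta1 m\<bar> \<le> 1 * 2 ^ k" for i m
    unfolding abs_mult using ex41_a_pos[of i] ex41_a_le[of i]
    by (intro mult_mono Suc) auto
  show ?case
    using *[of "n-1" "n-1"] *[of n "n+1"] unfolding funpow.simps o_apply ex41_J_def[of "(ex41_J ^^ k) delta1"]
    by auto
qed (simp add: delta1_def)

section \<open>The spectral measure: orthonormality, bounded support and the Nevai condition\<close>

context
  fixes \<rho> :: "real measure"
  assumes spec: "is_spectral_measure_ex41 \<rho>"
begin

lemma sets_spec [measurable_cong]: "sets \<rho> = sets borel"
  using spec by (simp add: is_spectral_measure_ex41_def)

lemma integrable_power_spec: "integrable \<rho> (\<lambda>x. x ^ k)"
  and integral_power_spec: "(\<integral>x. x ^ k \<partial>\<rho>) = ex41_moment k"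
  using spec by (auto simp: is_spectral_measure_ex41_def)

lemma integrable_poly_spec: "integrable \<rho> (\<lambda>x. poly q x)"
  unfolding poly_altdef by (intro integrable_power_spec Bochner_Integration.integrable_sum integrable_mult_right)

lemma integrable_power_p: "integrable \<rho> (\<lambda>x. x ^ k * ex41_p n x)"
  using integrable_poly_spec[of "monom 1 k * ex41_poly n"] by (simp add: poly_monom poly_ex41_poly)

lemma integrable_p_p: "integrable \<rho> (\<lambda>x. ex41_p m x * ex41_p n x)"
  using integrable_poly_spec[of "ex41_poly m * ex41_poly n"] by (simp add: poly_ex41_poly)

text \<open>Reflects the identity p_n(J) delta_1 = delta_(n+1). The recurrence for
  \<open>ex41_p\<close> matches the action of J on \<open>unit_vec\<close>, and every factor x
  becomes one more application of J.\<close>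

lemma integral_power_p: "(\<integral>x. x ^ k * ex41_p n x \<partial>\<rho>) = (ex41_J ^^ k) (unit_vec (Suc n)) 1"
proof (induction n arbitrary: k rule: ex41_poly.induct)
  case 1
  have "delta1 = unit_vec (Suc 0)"
    by (auto simp: delta1_def unit_vec_def)
  then show ?case
    by (simp add: integral_power_spec ex41_moment_def)
next
  case 2
  have d: "delta1 = unit_vec (Suc 0)"
    by (auto simp: delta1_def unit_vec_def)
  have "(\<integral>x. x ^ k * ex41_p (Suc 0) x \<partial>\<rho>) = (\<integral>x. x ^ Suc k / ex41_a (Suc 0) \<partial>\<rho>)"
    by (rule Bochner_Integration.integral_cong) (auto simp: ex41_p.simps)
  also have "\<dots> = ex41_moment (Suc k) / ex41_a (Suc 0)"
    using integral_power_spec[of "Suc k"] by simp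
  also have "ex41_moment (Suc k) = (ex41_J ^^ k) (ex41_J (unit_vec (Suc 0))) 1"
    by (simp add: ex41_moment_def d funpow_swap1)
  also have "\<dots> = ex41_a (Suc 0) * (ex41_J ^^ k) (unit_vec (Suc (Suc 0))) 1"
    unfolding J_unit_vec_1 J_pow_scale ..
  finally show ?case by simp
next
  case (3 n)
  have "(\<integral>x. x ^ k * ex41_p (Suc (Suc n)) x \<partial>\<rho>) =
      (\<integral>x. (x ^ Suc k * ex41_p (Suc n) x - ex41_a (Suc n) * (x ^ k * ex41_p n x)) / ex41_a (Suc (Suc n)) \<partial>\<rho>)"
    by (rule Bochner_Integration.integral_cong) (auto simp: ex41_p.simps algebra_simps)
  also have "\<dots> = ((\<integral>x. x ^ Suc k * ex41_p (Suc n) x \<partial>\<rho>) - ex41_a (Suc n) * (\<integral>x. x ^ k * ex41_p n x \<partial>\<rho>))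
      / ex41_a (Suc (Suc n))"
    using integrable_power_p[of "Suc k" "Suc n"] integrable_power_p[of k n]
    by (simp only: Bochner_Integration.integral_divide_zero Bochner_Integration.integral_diff
        integrable_mult_right integral_mult_right_zero)
  also have "(\<integral>x. x ^ Suc k * ex41_p (Suc n) x \<partial>\<rho>) = (ex41_J ^^ k) (ex41_J (unit_vec (Suc (Suc n)))) 1"
    unfolding 3 by (simp add: funpow_swap1)
  also have "\<dots> = ex41_a (Suc n) * (ex41_J ^^ k) (unit_vec (Suc n)) 1
      + ex41_a (Suc (Suc n)) * (ex41_J ^^ k) (unit_vec (Suc (Suc (Suc n)))) 1"
    unfolding J_unit_vec J_pow_linear ..
  finally show ?case by (simp add: 3)
qed

text \<open>Induction along the recurrence in the first index. The second index stays general
  because moving the factor x across the product shifts it by one.\<close>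

lemma orthonormal: "(\<integral>x. ex41_p m x * ex41_p n x \<partial>\<rho>) = (if m = n then 1 else 0)"
proof (induction m arbitrary: n rule: ex41_poly.induct)
  case 1
  then show ?case
    using integral_power_p[of 0 n] by (auto simp: unit_vec_def)
next
  case 2
  have "(\<integral>x. ex41_p (Suc 0) x * ex41_p n x \<partial>\<rho>) = (\<integral>x. x * ex41_p n x \<partial>\<rho>) / ex41_a (Suc 0)"
    by (simp add: ex41_p.simps(2))
  also have "(\<integral>x. x * ex41_p n x \<partial>\<rho>) = (if n = Suc 0 then ex41_a (Suc 0) else 0)"
    using integral_power_p[of 1 n] by (auto simp: ex41_J_def unit_vec_def)
  finally show ?case by auto
next
  case (3 m)
  have int: "integrable \<rho> (\<lambda>x. x * ex41_p i x * ex41_p j x)" for i j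
    using integrable_poly_spec[of "[:0,1:] * ex41_poly i * ex41_poly j"] by (simp add: poly_ex41_poly mult.assoc)
  have "(\<integral>x. ex41_p (Suc (Suc m)) x * ex41_p n x \<partial>\<rho>) =
      (\<integral>x. (x * ex41_p (Suc m) x * ex41_p n x - ex41_a (Suc m) * (ex41_p m x * ex41_p n x))
        / ex41_a (Suc (Suc m)) \<partial>\<rho>)"
    by (rule Bochner_Integration.integral_cong) (simp_all add: ex41_p.simps(3) left_diff_distrib mult.assoc)
  also have "\<dots> = ((\<integral>x. x * ex41_p (Suc m) x * ex41_p n x \<partial>\<rho>)
       - ex41_a (Suc m) * (\<integral>x. ex41_p m x * ex41_p n x \<partial>\<rho>)) / ex41_a (Suc (Suc m))"
    using int[of "Suc m" n] integrable_p_p[of m n]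
    by (simp only: Bochner_Integration.integral_divide_zero Bochner_Integration.integral_diff
        integrable_mult_right integral_mult_right_zero)
  \<comment> \<open>Symmetry of J: the factor x is moved onto \<open>ex41_p n\<close> and expanded
    by the recurrence. The case \<open>n = 0\<close> is separate because there p_(-1) = 0 and the
    lower term is absent.\<close>
  also have "(\<integral>x. x * ex41_p (Suc m) x * ex41_p n x \<partial>\<rho>) =
     (if n = 0 then ex41_a (Suc n) * (if m = n then 1 else 0)
      else ex41_a (Suc n) * (if m = n then 1 else 0) + ex41_a n * (if Suc m = n - 1 then 1 else 0))"
  proof (cases n)
    case 0
    have "(\<integral>x. x * ex41_p (Suc m) x * ex41_p n x \<partial>\<rho>) =
        (\<integral>x. ex41_a (Suc 0) * (ex41_p (Suc m) x * ex41_p (Suc 0) x) \<partial>\<rho>)"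
      unfolding 0 by (rule Bochner_Integration.integral_cong) (simp_all add: ex41_p.simps(2))
    also have "\<dots> = ex41_a (Suc 0) * (if m = 0 then 1 else 0)"
      using 3(1)[of "Suc 0"] by simp
    finally show ?thesis using 0 by simp
  next
    case (Suc l)
    have "(\<integral>x. x * ex41_p (Suc m) x * ex41_p n x \<partial>\<rho>) =
        (\<integral>x. ex41_a (Suc n) * (ex41_p (Suc m) x * ex41_p (Suc n) x)
           + ex41_a n * (ex41_p (Suc m) x * ex41_p l x) \<partial>\<rho>)"
    proof (rule Bochner_Integration.integral_cong[OF refl])
      fix x
      have rec: "x * ex41_p n x = ex41_a (Suc n) * ex41_p (Suc n) x + ex41_a n * ex41_p l x"
        using ex41_p_rec[of l x] Suc by simp
      have "x * ex41_p (Suc m) x * ex41_p n x = ex41_p (Suc m) x * (x * ex41_p n x)"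
        by simp
      also have "\<dots> = ex41_a (Suc n) * (ex41_p (Suc m) x * ex41_p (Suc n) x)
           + ex41_a n * (ex41_p (Suc m) x * ex41_p l x)"
        unfolding rec by (simp add: algebra_simps)
      finally show "x * ex41_p (Suc m) x * ex41_p n x = \<dots>" .
    qed
    also have "\<dots> = ex41_a (Suc n) * (\<integral>x. ex41_p (Suc m) x * ex41_p (Suc n) x \<partial>\<rho>)
        + ex41_a n * (\<integral>x. ex41_p (Suc m) x * ex41_p l x \<partial>\<rho>)"
      using integrable_p_p by simp
    finally show ?thesis using Suc 3(1) by simp
  qed
  finally show ?case
    unfolding 3(2) by (cases n) auto
qed

text \<open>Markov's inequality for the moment of order 2k: it is at most 4^k, whereas x^(2k) is at
  least 9^k where |x| is at least 3, so the mass there is at most (4/9)^k for every k.\<close>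

lemma AE_spec_bounded: "AE x in \<rho>. \<bar>x\<bar> < 3"
proof -
  let ?B = "{x::real. \<bar>x\<bar> \<ge> 3}"
  have fin: "finite_measure \<rho>"
    using integrable_power_spec[of 0]
    by (intro finite_measureI) (simp add: integrable_iff_bounded)
  interpret finite_measure \<rho> by (rule fin)
  have [measurable]: "?B \<in> sets \<rho>"
    unfolding sets_spec by measurable
  have sp: "space \<rho> = UNIV"
    using sets_eq_imp_space_eq[OF sets_spec] by simp
  have "measure \<rho> ?B \<le> (4/9) ^ k" for k
  proof -
    have "9 ^ k * measure \<rho> ?B = (\<integral>x. 9 ^ k * indicator ?B x \<partial>\<rho>)"
      by (simp add: sp)
    also have "\<dots> \<le> (\<integral>x. x ^ (2 * k) \<partial>\<rho>)"
    proof (rule integral_mono)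
      show "integrable \<rho> (\<lambda>x. 9 ^ k * indicator ?B x :: real)"
        by (intro integrable_mult_right integrable_real_indicator) (auto simp: emeasure_eq_measure)
      show "integrable \<rho> (\<lambda>x. x ^ (2 * k))"
        by (rule integrable_power_spec)
      fix x :: real
      have "3\<^sup>2 \<le> x\<^sup>2" if "\<bar>x\<bar> \<ge> 3"
        using that by (metis abs_le_square_iff abs_numeral)
      then have "9 ^ k \<le> (x\<^sup>2) ^ k" if "\<bar>x\<bar> \<ge> 3"
        using that by (intro power_mono) auto
      then show "9 ^ k * indicator ?B x \<le> x ^ (2 * k)"
        by (auto simp: indicator_def power_mult)
    qed
    also have "\<dots> \<le> 2 ^ (2 * k)"
      using abs_J_pow_delta1[of "2 * k" 1] unfolding integral_power_spec ex41_moment_def by linarith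
    also have "(2::real) ^ (2 * k) = 4 ^ k"
      by (simp add: power_mult)
    finally show ?thesis
      by (simp add: field_simps power_divide)
  qed
  moreover have "(\<lambda>k. (4/9 :: real) ^ k) \<longlonglongrightarrow> 0"
    by (intro LIMSEQ_power_zero) auto
  ultimately have "measure \<rho> ?B \<le> 0"
    by (intro LIMSEQ_le_const) auto
  then have "emeasure \<rho> ?B = 0"
    by (simp only: emeasure_eq_measure measure_le_0_iff ennreal_0)
  then show ?thesis
    by (intro AE_I[of _ _ ?B]) (auto simp: not_less)
qed

text \<open>Christoffel-Darboux writes \<open>(x - y) * ex41_K n x y\<close> as a combination of two
  orthonormal functions of x, so only the squares of the coefficients survive.\<close>

lemma integral_K_second_moment:
  "(\<integral>x. (x - y)\<^sup>2 * (ex41_K n x y)\<^sup>2 \<partial>\<rho>) =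
     (ex41_a (Suc n))\<^sup>2 * ((ex41_p n y)\<^sup>2 + (ex41_p (Suc n) y)\<^sup>2)"
proof -
  have "(x - y)\<^sup>2 * (ex41_K n x y)\<^sup>2 = (ex41_a (Suc n))\<^sup>2 *
      ((ex41_p n y)\<^sup>2 * (ex41_p (Suc n) x * ex41_p (Suc n) x)
       + (ex41_p (Suc n) y)\<^sup>2 * (ex41_p n x * ex41_p n x)
       - 2 * ex41_p n y * ex41_p (Suc n) y * (ex41_p (Suc n) x * ex41_p n x))" for x
    unfolding power_mult_distrib[symmetric] christoffel_darboux
    by (simp add: power2_eq_square algebra_simps)
  then show ?thesis
    using integrable_p_p by (simp add: orthonormal)
qed

lemma nevai_imp_p_sq_over_K:
  assumes "nevai_at \<rho> y" "\<bar>y\<bar> \<le> 2"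
  shows "(\<lambda>n. (ex41_p n y)\<^sup>2 / ex41_K n y y) \<longlonglongrightarrow> 0"
proof -
  \<comment> \<open>Nevai is tested on (x - y)^2, truncated to be bounded. The cap 25 = (3 + 2)^2 is
    never exceeded where |x| < 3 and |y| \<le> 2, hence almost everywhere.\<close>
  define f where "f = (\<lambda>x. min ((x - y)\<^sup>2) 25)"
  have f: "continuous_on UNIV f" "bounded (range f)"
    unfolding f_def by (auto intro!: continuous_intros boundedI[of _ 25])
  have [measurable]: "f \<in> borel_measurable borel"
    using f(1) by (rule borel_measurable_continuous_onI)
  have [measurable]: "(\<lambda>x. ex41_K n x y) \<in> borel_measurable borel" for n
    unfolding ex41_K_def by (intro borel_measurable_continuous_onI continuous_intros)
  have eq: "(\<integral>x. f x * (ex41_K n x y)\<^sup>2 \<partial>\<rho>) = (\<integral>x. (x - y)\<^sup>2 * (ex41_K n x y)\<^sup>2 \<partial>\<rho>)" for n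
  proof (rule integral_cong_AE)
    show "AE x in \<rho>. f x * (ex41_K n x y)\<^sup>2 = (x - y)\<^sup>2 * (ex41_K n x y)\<^sup>2"
      using AE_spec_bounded
    proof eventually_elim
      case (elim x)
      then have "\<bar>x - y\<bar> \<le> \<bar>5\<bar>" using assms(2) by linarith
      then have "(x - y)\<^sup>2 \<le> 5\<^sup>2" by (simp only: abs_le_square_iff)
      then show ?case by (simp add: f_def)
    qed
  qed measurable
  have "(\<lambda>n. (\<integral>x. f x * (ex41_K n x y)\<^sup>2 \<partial>\<rho>) / ex41_K n y y) \<longlonglongrightarrow> f y"
    using assms(1) f by (auto simp: nevai_at_def)
  then have "(\<lambda>n. (ex41_a (Suc n))\<^sup>2 * ((ex41_p n y)\<^sup>2 + (ex41_p (Suc n) y)\<^sup>2) / ex41_K n y y) \<longlonglongrightarrow> 0"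
    unfolding eq integral_K_second_moment by (simp add: f_def)
  \<comment> \<open>The factor 4 absorbs the lower bound 1/4 for the squared coefficient.\<close>
  from tendsto_mult_right[OF this, of 4]
  have lim: "(\<lambda>n. 4 * ((ex41_a (Suc n))\<^sup>2 * ((ex41_p n y)\<^sup>2 + (ex41_p (Suc n) y)\<^sup>2) / ex41_K n y y)) \<longlonglongrightarrow> 0"
    by (simp add: mult.commute)
  show ?thesis
  proof (rule tendsto_sandwich[OF _ _ tendsto_const lim])
    show "\<forall>\<^sub>F n in sequentially. 0 \<le> (ex41_p n y)\<^sup>2 / ex41_K n y y"
      using ex41_K_pos by (auto intro!: always_eventually divide_nonneg_pos)
    have "(ex41_p n y)\<^sup>2 \<le> 4 * ((ex41_a (Suc n))\<^sup>2 * ((ex41_p n y)\<^sup>2 + (ex41_p (Suc n) y)\<^sup>2))" for n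
    proof -
      have "(1/2)\<^sup>2 \<le> (ex41_a (Suc n))\<^sup>2"
        by (intro power_mono ex41_a_ge) auto
      then have "1 * ((ex41_p n y)\<^sup>2 + (ex41_p (Suc n) y)\<^sup>2) \<le>
          (4 * (ex41_a (Suc n))\<^sup>2) * ((ex41_p n y)\<^sup>2 + (ex41_p (Suc n) y)\<^sup>2)"
        by (intro mult_right_mono) (auto simp: power2_eq_square)
      then show ?thesis
        unfolding mult.assoc by (rule order_trans[rotated]) simp
    qed
    from divide_right_mono[OF this less_imp_le[OF ex41_K_pos]]
    show "\<forall>\<^sub>F n in sequentially. (ex41_p n y)\<^sup>2 / ex41_K n y y \<le>
       4 * ((ex41_a (Suc n))\<^sup>2 * ((ex41_p n y)\<^sup>2 + (ex41_p (Suc n) y)\<^sup>2) / ex41_K n y y)"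
      by (auto intro!: always_eventually)
  qed
qed

end

section \<open>Total rotation and the measure of the exceptional sets\<close>

text \<open>Applied with \<open>R\<close> the zeros of p_n, at which the antiderivative arctan(s d /
  p_n) of the angular velocity breaks down. The points of \<open>R\<close> inside the interval cut
  it into one more piece than their number.\<close>

lemma integral_le_by_pieces:
  fixes D :: "real \<Rightarrow> real"
  assumes cont: "continuous_on {a..b} D" and fin: "finite R" and "a < b" and "0 \<le> B"
    and piece: "\<And>c d. a \<le> c \<Longrightarrow> c < d \<Longrightarrow> d \<le> b \<Longrightarrow> {c..d} \<inter> R = {} \<Longrightarrow> integral {c..d} D \<le> B"
  shows "integral {a..b} D \<le> B * (card (R \<inter> {a<..<b}) + 1)"
proof -
  have intD: "D integrable_on {c..d}" if "a \<le> c" "d \<le> b" for c d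
    using continuous_on_subset[OF cont, of "{c..d}"] that by (intro integrable_continuous_interval) auto
  \<comment> \<open>Endpoints may lie in \<open>R\<close>, so the hypothesis is used on slightly
    shorter intervals and the limit is taken by continuity of the indefinite integral.\<close>
  have open_piece: "integral {c..d} D \<le> B" if cd: "a \<le> c" "c < d" "d \<le> b" "R \<inter> {c<..<d} = {}" for c d
  proof -
    define I where "I = (\<lambda>t. integral {c..t} D)"
    have contI: "continuous_on {c..d} I"
      unfolding I_def using intD cd by (intro indefinite_integral_continuous_1) auto
    define h where "h = (\<lambda>n::nat. (d - c) / (real n + 3))"
    define u where "u = (\<lambda>n. c + h n)"
    define v where "v = (\<lambda>n. d - h n)"
    have uv: "c < u n" "u n < v n" "v n < d" for n
    proof -
      have "h n \<le> (d - c) / 3"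
        unfolding h_def using cd by (intro frac_le) auto
      moreover have "h n > 0"
        using cd by (auto simp: h_def)
      ultimately show "c < u n" "u n < v n" "v n < d"
        using cd by (auto simp: u_def v_def field_simps)
    qed
    have uvI: "u n \<in> {c..d}" "v n \<in> {c..d}" for n
      using uv[of n] by auto
    have "u \<longlonglongrightarrow> c" "v \<longlonglongrightarrow> d"
      unfolding u_def v_def h_def by real_asymp+
    then have "(\<lambda>n. I (u n)) \<longlonglongrightarrow> I c" "(\<lambda>n. I (v n)) \<longlonglongrightarrow> I d"
      using uvI cd by (auto intro!: continuous_on_tendsto_compose[OF contI] always_eventually)
    then have "(\<lambda>n. I (v n) - I (u n)) \<longlonglongrightarrow> I d - I c"
      by (intro tendsto_diff)
    moreover have "I (v n) - I (u n) \<le> B" for n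
    proof -
      have "I (u n) + integral {u n..v n} D = I (v n)"
        unfolding I_def using uv[of n] cd by (intro Henstock_Kurzweil_Integration.integral_combine intD) auto
      moreover have "integral {u n..v n} D \<le> B"
      proof (rule piece)
        have "{u n..v n} \<subseteq> {c<..<d}"
          using uv[of n] by auto
        then show "{u n..v n} \<inter> R = {}"
          using cd(4) by blast
      qed (use uv[of n] cd in auto)
      ultimately show ?thesis by linarith
    qed
    ultimately have "I d - I c \<le> B"
      by (intro LIMSEQ_le_const2) auto
    then show ?thesis by (simp add: I_def)
  qed
  \<comment> \<open>Strong induction on the number of interior points of \<open>R\<close>, splitting
    at one of them.\<close>
  have "integral {c..d} D \<le> B * (card (R \<inter> {c<..<d}) + 1)" if "a \<le> c" "c < d" "d \<le> b" for c d
    using that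
  proof (induction "card (R \<inter> {c<..<d})" arbitrary: c d rule: less_induct)
    case less
    show ?case
    proof (cases "R \<inter> {c<..<d} = {}")
      case True
      then show ?thesis using open_piece less.prems by simp
    next
      case False
      then obtain r where r: "r \<in> R" "c < r" "r < d" by auto
      let ?L = "R \<inter> {c<..<r}" and ?U = "R \<inter> {r<..<d}"
      have eq: "R \<inter> {c<..<d} = insert r (?L \<union> ?U)"
        using r by auto
      have card: "card (R \<inter> {c<..<d}) = Suc (card ?L + card ?U)"
        unfolding eq using fin by (subst card_insert_disjoint) (auto intro!: card_Un_disjoint)
      have "integral {c..r} D \<le> B * (card ?L + 1)" "integral {r..d} D \<le> B * (card ?U + 1)"
        using r less.prems card by (intro less.hyps; simp)+
      moreover have "integral {c..r} D + integral {r..d} D = integral {c..d} D"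
        using r less.prems by (intro Henstock_Kurzweil_Integration.integral_combine intD) auto
      ultimately show ?thesis
        unfolding card by (simp add: algebra_simps)
    qed
  qed
  then show ?thesis using \<open>a < b\<close> by simp
qed

text \<open>
  The decaying solutions of \<open>u\<^sub>k\<^sub>+\<^sub>1 = 2 x u\<^sub>k - u\<^sub>k\<^sub>-\<^sub>1\<close>, the recurrence inside a C-block, are the
  multiples of \<open>contr x ^ k\<close>.
\<close>

definition contr :: "real \<Rightarrow> real" where
  "contr x = x - sqrt (x\<^sup>2 - 1)"

definition contr' :: "real \<Rightarrow> real" where
  "contr' x = 1 - x / sqrt (x\<^sup>2 - 1)"

lemma square_gt_1: "(x::real) > 1 \<Longrightarrow> x\<^sup>2 - 1 > 0"
  by (simp add: power2_eq_square less_1_mult)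

lemma contr_deriv:
  assumes "x > 1"
  shows "(contr has_real_derivative contr' x) (at x within S)"
  unfolding contr_def contr'_def using square_gt_1[OF assms]
  by (auto intro!: derivative_eq_intros simp: field_simps)

text \<open>This sign makes the motion of the contracting direction reinforce the rotation instead
  of opposing it.\<close>

lemma contr'_nonpos:
  assumes "x > 1"
  shows "contr' x \<le> 0"
proof -
  have "sqrt (x\<^sup>2 - 1) \<le> sqrt (x\<^sup>2)" by (intro real_sqrt_le_mono) simp
  then show ?thesis using assms square_gt_1[OF assms] by (simp add: contr'_def field_simps)
qed

text \<open>\<open>contr x\<close> and \<open>2 * x - contr x\<close> are the two roots of t^2 - 2 x
  t + 1, hence have product 1; the second is the expanding one.\<close>

lemma contr_bounds:
  assumes "x > 1"
  shows "0 \<le> contr x" "contr x \<le> 1" "contr x * (2 * x - contr x) = 1" "2 * x - contr x \<ge> x"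
proof -
  have s: "sqrt (x\<^sup>2 - 1) \<le> sqrt (x\<^sup>2)" by (intro real_sqrt_le_mono) simp
  then show nn: "0 \<le> contr x" using assms by (simp add: contr_def)
  show "2 * x - contr x \<ge> x" using square_gt_1[OF assms] by (simp add: contr_def)
  then have g: "2 * x - contr x \<ge> 1" using assms by linarith
  show eq: "contr x * (2 * x - contr x) = 1"
    using square_gt_1[OF assms] by (simp add: contr_def algebra_simps flip: power2_eq_square)
  have "contr x * 1 \<le> contr x * (2 * x - contr x)"
    using nn g by (intro mult_left_mono) auto
  then show "contr x \<le> 1" using eq by simp
qed

text \<open>
  The vector \<open>(p\<^sub>n, p\<^sub>n\<^sub>+\<^sub>1 - contr p\<^sub>n)\<close>, with its second entry scaled by
  \<open>s = 1 / sqrt \<epsilon>\<close>, turns with angular velocity at least \<open>s / 2\<close> on the set below,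
  while its total turning is at most \<open>\<pi>\<close> times one plus the number of zeros of \<open>p\<^sub>n\<close>.
\<close>

lemma near_contracting_measure:
  fixes c b \<epsilon> :: real and n :: nat
  assumes "1 < c" "c < b" "\<epsilon> > 0"
  defines "B \<equiv> {x \<in> {c..b}. (ex41_p (Suc n) x - contr x * ex41_p n x)\<^sup>2 \<le> \<epsilon> * ex41_K n x x}"
  shows "B \<in> sets borel" "emeasure lborel B \<le> ennreal (2 * pi * (n + 1) * sqrt \<epsilon>)"
proof -
  define s where "s = 1 / sqrt \<epsilon>"
  have s: "s > 0" "s\<^sup>2 * \<epsilon> = 1"
    using assms by (auto simp: s_def power_divide)
  define d where "d = (\<lambda>x. ex41_p (Suc n) x - contr x * ex41_p n x)"
  define d' where "d' = (\<lambda>x. ex41_p' (Suc n) x - contr' x * ex41_p n x - contr x * ex41_p' n x)"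
  \<comment> \<open>\<open>w\<close> is the Wronskian of p_n and \<open>d\<close>. \<open>D\<close>
    is the angular velocity of the vector (p_n, s d); it equals the derivative of arctan(s d / p_n)
    away from the zeros of p_n and stays continuous across them since \<open>N\<close> is
    positive.\<close>
  define w where "w = (\<lambda>x. d' x * ex41_p n x - d x * ex41_p' n x)"
  define N where "N = (\<lambda>x. (ex41_p n x)\<^sup>2 + s\<^sup>2 * (d x)\<^sup>2)"
  define D where "D = (\<lambda>x. s * w x / N x)"
  have w_ge: "w x \<ge> ex41_K n x x" if "x > 1" for x
  proof -
    let ?W = "ex41_p' (Suc n) x * ex41_p n x - ex41_p (Suc n) x * ex41_p' n x"
    have "w x = ?W - contr' x * (ex41_p n x)\<^sup>2"
      by (simp add: w_def d_def d'_def power2_eq_square algebra_simps)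
    moreover have "contr' x * (ex41_p n x)\<^sup>2 \<le> 0"
      using contr'_nonpos[OF that] by (intro mult_nonpos_nonneg) auto
    moreover have "?W \<ge> ex41_K n x x"
    proof -
      have eq: "ex41_a (Suc n) * ?W = ex41_K n x x" by (rule wronskian)
      then have "?W > 0"
        using ex41_K_pos[of n x] ex41_a_pos[of "Suc n"] by (metis zero_less_mult_pos)
      then have "ex41_a (Suc n) * ?W \<le> 1 * ?W"
        using ex41_a_le by (intro mult_right_mono) auto
      then show ?thesis using eq by simp
    qed
    ultimately show ?thesis by linarith
  qed
  have w_pos: "w x > 0" if "x > 1" for x
    using w_ge[OF that] ex41_K_pos[of n x] by linarith
  have N_pos: "N x > 0" if "x > 1" for x
  proof -
    have "ex41_p n x \<noteq> 0 \<or> d x \<noteq> 0"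
      using w_pos[OF that] by (auto simp: w_def)
    then show ?thesis
      using s by (auto simp: N_def intro: add_pos_nonneg add_nonneg_pos)
  qed
  have D_pos: "D x > 0" if "x > 1" for x
    using w_pos[OF that] N_pos[OF that] s by (simp add: D_def)
  have gt1: "x > 1" if "x \<in> {c..b}" for x
    using that assms by auto
  have cont_contr: "continuous_on {c..b} contr" "continuous_on {c..b} contr'"
    unfolding contr_def contr'_def using square_gt_1[OF gt1]
    by (intro continuous_intros; force)+
  have cont_d: "continuous_on {c..b} d"
    unfolding d_def by (intro continuous_intros cont_contr)
  have cont_D: "continuous_on {c..b} D"
    unfolding D_def w_def d'_def N_def using N_pos[OF gt1, unfolded N_def]
    by (intro continuous_intros cont_contr cont_d) force
  have piece: "integral {u..v} D \<le> pi"
    if "c \<le> u" "u < v" "v \<le> b" "{u..v} \<inter> {x. ex41_p n x = 0} = {}" for u v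
  proof -
    have "((\<lambda>x. arctan (s * (d x / ex41_p n x))) has_vector_derivative D x) (at x within {u..v})"
      if x: "x \<in> {u..v}" for x
    proof -
      have x1: "x > 1" and nz: "ex41_p n x \<noteq> 0"
        using x \<open>c \<le> u\<close> assms \<open>_ = {}\<close> by auto
      have dd: "(d has_real_derivative d' x) (at x within {u..v})"
        unfolding d_def d'_def
        by (auto intro!: derivative_eq_intros contr_deriv[OF x1])
      have "((\<lambda>x. arctan (s * (d x / ex41_p n x))) has_real_derivative
         inverse (1 + (s * (d x / ex41_p n x))\<^sup>2) *
           (s * ((d' x * ex41_p n x - d x * (ex41_p' n x * 1)) / (ex41_p n x * ex41_p n x)))) (at x within {u..v})"
        using nz by (intro DERIV_chain2[OF DERIV_arctan] DERIV_cmult DERIV_divide dd ex41_p_deriv DERIV_ident) auto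
      also have "inverse (1 + (s * (d x / ex41_p n x))\<^sup>2) *
           (s * ((d' x * ex41_p n x - d x * (ex41_p' n x * 1)) / (ex41_p n x * ex41_p n x))) = D x"
      proof -
        have "1 + (s * (d x / ex41_p n x))\<^sup>2 = N x / (ex41_p n x)\<^sup>2"
          using nz by (simp add: N_def field_simps power2_eq_square)
        then show ?thesis
          using nz by (simp add: D_def w_def power2_eq_square)
      qed
      finally show ?thesis
        by (simp add: has_real_derivative_iff_has_vector_derivative)
    qed
    then have "(D has_integral arctan (s * (d v / ex41_p n v)) - arctan (s * (d u / ex41_p n u))) {u..v}"
      using that by (intro fundamental_theorem_of_calculus) auto
    then have "integral {u..v} D = arctan (s * (d v / ex41_p n v)) - arctan (s * (d u / ex41_p n u))"
      by (rule integral_unique)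
    then show ?thesis
      using arctan_bounded[of "s * (d v / ex41_p n v)"] arctan_bounded[of "s * (d u / ex41_p n u)"]
      by linarith
  qed
  have "integral {c..b} D \<le> pi * (card ({x. ex41_p n x = 0} \<inter> {c<..<b}) + 1)"
    using cont_D ex41_p_roots(1) assms(2) pi_ge_zero piece by (rule integral_le_by_pieces)
  also have "\<dots> \<le> pi * (n + 1)"
  proof -
    have "card ({x. ex41_p n x = 0} \<inter> {c<..<b}) \<le> card {x. ex41_p n x = 0}"
      using ex41_p_roots(1) by (intro card_mono) auto
    also have "\<dots> \<le> n" by (rule ex41_p_roots)
    finally show ?thesis by (intro mult_left_mono) auto
  qed
  finally have int_le: "integral {c..b} D \<le> pi * (n + 1)" .
  have "closed {x \<in> {c..b}. (d x)\<^sup>2 \<le> \<epsilon> * ex41_K n x x}"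
    unfolding ex41_K_def
    by (intro continuous_closed_preimage_constant continuous_on_closed_Collect_le continuous_intros cont_d closed_atLeastAtMost)
  then have clB: "closed B" by (simp add: B_def d_def)
  then show B: "B \<in> sets borel" by simp
  \<comment> \<open>On \<open>B\<close> both squares in \<open>N\<close> are at most K_n, so
    \<open>N\<close> is at most 2 K_n, hence at most \<open>2 * w\<close>.\<close>
  have BD: "s / 2 \<le> D x" if "x \<in> B" for x
  proof -
    have x1: "x > 1" and dx: "(d x)\<^sup>2 \<le> \<epsilon> * ex41_K n x x"
      using that gt1 by (auto simp: B_def d_def)
    have "s\<^sup>2 * (d x)\<^sup>2 \<le> s\<^sup>2 * (\<epsilon> * ex41_K n x x)"
      using dx by (intro mult_left_mono) auto
    also have "\<dots> = ex41_K n x x"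
      using s by (simp flip: mult.assoc)
    finally have "N x \<le> 2 * ex41_K n x x"
      using ex41_p_sq_le_K[of n x] by (simp add: N_def)
    also have "\<dots> \<le> 2 * w x" using w_ge[OF x1] by simp
    finally have "s * N x \<le> s * (2 * w x)"
      using s by (intro mult_left_mono) auto
    then show ?thesis
      using N_pos[OF x1] by (simp add: D_def field_simps)
  qed
  \<comment> \<open>Chebyshev's inequality for \<open>D\<close>, which is positive on the whole
    interval.\<close>
  have "ennreal (s / 2) * emeasure lborel B = (\<integral>\<^sup>+x. ennreal (s / 2) * indicator B x \<partial>lborel)"
    using B by (simp add: nn_integral_cmult_indicator)
  also have "\<dots> \<le> (\<integral>\<^sup>+x. ennreal (D x) * indicator {c..b} x \<partial>lborel)"
    using BD by (intro nn_integral_mono) (auto simp: B_def indicator_def intro: ennreal_leI)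
  also have "\<dots> = ennreal (integral {c..b} D)"
  proof -
    have "set_integrable lborel {c..b} D"
      using cont_D by (rule borel_integrable_atLeastAtMost')
    then have i: "integrable lborel (\<lambda>x. indicator {c..b} x *\<^sub>R D x)"
      by (simp add: set_integrable_def)
    have "(\<integral>\<^sup>+x. ennreal (D x) * indicator {c..b} x \<partial>lborel) = (\<integral>\<^sup>+x. ennreal (indicator {c..b} x *\<^sub>R D x) \<partial>lborel)"
      by (intro nn_integral_cong) (auto simp: indicator_def)
    also have "\<dots> = ennreal (\<integral>x. indicator {c..b} x *\<^sub>R D x \<partial>lborel)"
      using i D_pos[OF gt1] by (intro nn_integral_eq_integral) (auto simp: indicator_def less_imp_le)
    also have "(\<integral>x. indicator {c..b} x *\<^sub>R D x \<partial>lborel) = integral {c..b} D"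
      using set_borel_integral_eq_integral(2)[OF \<open>set_integrable lborel {c..b} D\<close>]
      by (simp add: set_lebesgue_integral_def)
    finally show ?thesis .
  qed
  also have "\<dots> \<le> ennreal (pi * (n + 1))"
    using int_le by (rule ennreal_leI)
  finally have "ennreal (2 / s) * (ennreal (s / 2) * emeasure lborel B) \<le> ennreal (2 / s) * ennreal (pi * (n + 1))"
    by (rule mult_left_mono) simp
  moreover have "ennreal (2 / s) * (ennreal (s / 2) * emeasure lborel B) = emeasure lborel B"
    using s by (simp flip: mult.assoc ennreal_mult)
  moreover have "ennreal (2 / s) * ennreal (pi * (n + 1)) = ennreal (2 * pi * (n + 1) * sqrt \<epsilon>)"
    using s assms(3) by (subst ennreal_mult[symmetric]) (auto simp: s_def field_simps)
  ultimately show "emeasure lborel B \<le> ennreal (2 * pi * (n + 1) * sqrt \<epsilon>)"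
    by simp
qed

section \<open>Growth across one hyperbolic block\<close>

text \<open>The non-contracting component grows by a factor at least c per step, its square by at
  least c^2, while the kernel grows by at most c. Comparing the two at the end of the block leaves
  the gain \<open>c ^ L\<close>.\<close>

lemma hyperbolic_block:
  fixes c x :: real
  assumes c: "1 < c" "c \<le> x" and L: "L \<ge> 1"
    and half: "\<And>i. 1 \<le> i \<Longrightarrow> i \<le> L \<Longrightarrow> ex41_a (M + i) = 1/2"
    and small: "\<And>n. n \<ge> M \<Longrightarrow> (ex41_p n x)\<^sup>2 \<le> (1 - 1 / c) * ex41_K n x x"
  shows "(ex41_p (Suc M) x - contr x * ex41_p M x)\<^sup>2 \<le> 2 * c\<^sup>2 / c ^ L * ex41_K M x x"
proof -
  have x: "x > 1" using c by simp
  note cb = contr_bounds[OF x]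
  define l where "l = 2 * x - contr x"
  have l: "c \<le> l" using cb c by (simp add: l_def)
  define d where "d = (\<lambda>k. ex41_p (Suc (M + k)) x - contr x * ex41_p (M + k) x)"
  \<comment> \<open>The step to \<open>d (Suc k)\<close> involves the coefficients at sites M+k+1
    and M+k+2, both of which must lie in the block. Hence only L - 1 factors are gained, which costs
    the \<open>c\<^sup>2\<close> in the bound.\<close>
  have d: "d k = l ^ k * d 0" if "k < L" for k
    using that
  proof (induction k)
    case (Suc k)
    have a: "ex41_a (Suc (M + k)) = 1/2" "ex41_a (Suc (Suc (M + k))) = 1/2"
      using half[of "Suc k"] half[of "Suc (Suc k)"] Suc.prems by auto
    have "ex41_p (Suc (Suc (M + k))) x = 2 * x * ex41_p (Suc (M + k)) x - ex41_p (M + k) x"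
      unfolding ex41_p.simps(3) a by (simp add: field_simps)
    then have "d (Suc k) = l * ex41_p (Suc (M + k)) x - ex41_p (M + k) x"
      by (simp add: d_def l_def algebra_simps)
    also have "ex41_p (M + k) x = (contr x * l) * ex41_p (M + k) x"
      using cb(3) by (simp add: l_def)
    finally have "d (Suc k) = l * d k"
      by (simp add: d_def algebra_simps)
    then show ?case using Suc by simp
  qed simp
  \<comment> \<open>The threshold 1 - 1/c is chosen so that K_(n+1) \<le> c K_n follows
    exactly.\<close>
  have K: "ex41_K (M + k) x x \<le> c ^ k * ex41_K M x x" for k
  proof (induction k)
    case (Suc k)
    have "ex41_K (M + Suc k) x x \<le> ex41_K (M + k) x x + (1 - 1 / c) * ex41_K (M + Suc k) x x"
      using small[of "M + Suc k"] by (simp add: ex41_K_Suc power2_eq_square)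
    then have "ex41_K (M + Suc k) x x \<le> c * ex41_K (M + k) x x"
      using c by (simp add: field_simps)
    also have "\<dots> \<le> c * (c ^ k * ex41_K M x x)"
      using Suc c by (intro mult_left_mono) auto
    finally show ?case by (simp add: mult.assoc)
  qed simp
  obtain L' where L': "L = Suc L'" using L by (cases L) auto
  let ?u = "ex41_p (Suc (M + L')) x" and ?v = "ex41_p (M + L') x"
  have "(c ^ L')\<^sup>2 * (d 0)\<^sup>2 \<le> (l ^ L')\<^sup>2 * (d 0)\<^sup>2"
    using l c by (intro mult_right_mono power_mono) auto
  also have "\<dots> = (d L')\<^sup>2"
    using d[of L'] L' by (simp add: power_mult_distrib)
  also have "\<dots> \<le> 2 * (?u\<^sup>2 + ?v\<^sup>2)"
  proof -
    have "(?u - contr x * ?v)\<^sup>2 \<le> 2 * (?u\<^sup>2 + (contr x)\<^sup>2 * ?v\<^sup>2)"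
      using zero_le_power2[of "?u + contr x * ?v"] by (simp add: power2_eq_square algebra_simps)
    also have "\<dots> \<le> 2 * (?u\<^sup>2 + 1 * ?v\<^sup>2)"
      using cb by (intro mult_left_mono add_left_mono mult_right_mono power_le_one) auto
    finally show ?thesis by (simp add: d_def)
  qed
  also have "\<dots> \<le> 2 * ex41_K (M + L) x x"
    using ex41_p_sq_le_K[of "M + L'" x] by (simp add: L' ex41_K_Suc power2_eq_square)
  also have "\<dots> \<le> 2 * (c ^ L * ex41_K M x x)"
    using K by simp
  finally have "c\<^sup>2 * ((c ^ L')\<^sup>2 * (d 0)\<^sup>2) \<le> c\<^sup>2 * (2 * (c ^ L * ex41_K M x x))"
    by (intro mult_left_mono) auto
  then have "c ^ L * (c ^ L * (d 0)\<^sup>2) \<le> c ^ L * (2 * c\<^sup>2 * ex41_K M x x)"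
    by (simp add: L' power2_eq_square mult_ac)
  then have "c ^ L * (d 0)\<^sup>2 \<le> 2 * c\<^sup>2 * ex41_K M x x"
    using c by (simp add: mult_le_cancel_left_pos)
  then show ?thesis
    using c by (simp add: d_def field_simps)
qed

section \<open>Positions and lengths of the blocks\<close>

text \<open>For \<open>j \<ge> 1\<close> this is the last site of A_j, so that C_j starts right
  after it.\<close>

definition ex41_M :: "nat \<Rightarrow> nat" where
  "ex41_M j = ex41_start j + 3 ^ (j\<^sup>2)"

lemma ex41_start_Suc: "j \<ge> 1 \<Longrightarrow> ex41_start (Suc j) = ex41_M j + 2 ^ (j\<^sup>2)"
  by (simp add: ex41_start_def ex41_M_def)

lemma ex41_start_mono: "i \<le> j \<Longrightarrow> ex41_start i \<le> ex41_start j"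
  unfolding ex41_start_def by (intro sum_mono2) auto

lemma ex41_a_C_block:
  assumes "j \<ge> 1" "1 \<le> i" "i \<le> 2 ^ (j\<^sup>2)"
  shows "ex41_a (ex41_M j + i) = 1/2"
proof -
  have "\<not> ex41_inA (ex41_M j + i)"
  proof
    assume "ex41_inA (ex41_M j + i)"
    then obtain k where k: "k \<ge> 1" "ex41_start k < ex41_M j + i" "ex41_M j + i \<le> ex41_M k"
      by (auto simp: ex41_inA_def ex41_M_def)
    consider "k < j" | "k = j" | "k > j" by linarith
    then show False
    proof cases
      case 1
      then have "ex41_start (Suc k) \<le> ex41_start j" by (intro ex41_start_mono) auto
      then show False using k assms(2) ex41_start_Suc[of k] by (simp add: ex41_M_def[of j])
    next
      case 2
      then show False using k assms by simp
    next
      case 3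
      then have "ex41_start (Suc j) \<le> ex41_start k" by (intro ex41_start_mono) auto
      then show False using k assms ex41_start_Suc[of j] by simp
    qed
  qed
  then show ?thesis by (simp add: ex41_a_def)
qed

lemma ex41_M_ge: "j \<le> ex41_M j"
proof -
  have "j \<le> j\<^sup>2" by (simp add: power2_eq_square)
  also have "j\<^sup>2 < 3 ^ (j\<^sup>2)" by (rule less_exp[THEN order_less_le_trans]) (simp add: power_mono)
  finally show ?thesis by (simp add: ex41_M_def)
qed

text \<open>With y the length of C_j, 3 \<le> 2^2 bounds every earlier block, and A_j, by y^2, and j
  \<le> y bounds their number; so the degree of p_M is at most cubic in y.\<close>

lemma ex41_M_le: "real (ex41_M j) + 1 \<le> 4 * (2 ^ (j\<^sup>2)) ^ 3"
proof -
  let ?y = "2 ^ (j\<^sup>2) :: nat"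
  have y3: "3 ^ (i\<^sup>2) \<le> ?y\<^sup>2" if "i \<le> j" for i
  proof -
    have "(3::nat) ^ (i\<^sup>2) \<le> 3 ^ (j\<^sup>2)"
      using that by (intro power_increasing power_mono) auto
    also have "\<dots> \<le> 4 ^ (j\<^sup>2)" by (intro power_mono) auto
    also have "\<dots> = ?y\<^sup>2" by (simp add: power_mult[symmetric] mult.commute[of _ 2] power_mult[of 2 2])
    finally show ?thesis .
  qed
  have y2: "2 ^ (i\<^sup>2) \<le> ?y\<^sup>2" if "i \<le> j" for i
  proof -
    have "(2::nat) ^ (i\<^sup>2) \<le> 3 ^ (i\<^sup>2)" by (intro power_mono) auto
    then show ?thesis using y3[OF that] by linarith
  qed
  have jy: "j \<le> ?y"
  proof -
    have "j \<le> j\<^sup>2" by (simp add: power2_eq_square)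
    also have "j\<^sup>2 < ?y" by (rule less_exp)
    finally show ?thesis by simp
  qed
  have "ex41_start j \<le> (\<Sum>i\<in>{1..<j}. ?y\<^sup>2 + ?y\<^sup>2)"
    unfolding ex41_start_def using y2 y3 by (intro sum_mono add_mono) auto
  also have "\<dots> = (j - 1) * (2 * ?y\<^sup>2)" by simp
  also have "\<dots> \<le> j * (2 * ?y\<^sup>2)" by (intro mult_right_mono) auto
  also have "\<dots> \<le> ?y * (2 * ?y\<^sup>2)" using jy by (intro mult_right_mono) auto
  finally have "ex41_M j + 1 \<le> 2 * ?y ^ 3 + ?y\<^sup>2 + 1"
    using y3[of j] by (simp add: ex41_M_def power3_eq_cube power2_eq_square)
  also have "?y\<^sup>2 \<le> ?y ^ 3" by (intro power_increasing) auto
  also have "1 \<le> ?y ^ 3" by simp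
  finally have "ex41_M j + 1 \<le> 4 * ?y ^ 3" by simp
  then have "real (ex41_M j + 1) \<le> real (4 * ?y ^ 3)" by (rule of_nat_mono)
  then show ?thesis by simp
qed

lemma exceptional_measure_tendsto_0:
  fixes c :: real
  assumes "c > 1"
  shows "(\<lambda>j. 2 * pi * (ex41_M j + 1) * sqrt (2 * c\<^sup>2 / c ^ (2 ^ (j\<^sup>2)))) \<longlonglongrightarrow> 0"
proof -
  \<comment> \<open>The block length is replaced by a real variable y: the cubic factor loses
    against the decay c^(-y/2).\<close>
  have lim: "((\<lambda>y::real. 8 * pi * y ^ 3 * sqrt (2 * c\<^sup>2 / c powr y)) \<longlongrightarrow> 0) at_top"
    using assms by real_asymp
  have "filterlim (\<lambda>j::nat. (2::real) ^ (j\<^sup>2)) at_top sequentially"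
    by real_asymp
  from filterlim_compose[OF lim this]
  have "(\<lambda>j::nat. 8 * pi * (2 ^ (j\<^sup>2)) ^ 3 * sqrt (2 * c\<^sup>2 / c powr (2 ^ (j\<^sup>2)))) \<longlonglongrightarrow> 0" .
  moreover have "c powr (2 ^ (j\<^sup>2)) = c ^ (2 ^ (j\<^sup>2))" for j :: nat
    using powr_realpow[of c "2 ^ (j\<^sup>2)"] assms by simp
  ultimately
  have lim': "(\<lambda>j. 8 * pi * (2 ^ (j\<^sup>2)) ^ 3 * sqrt (2 * c\<^sup>2 / c ^ (2 ^ (j\<^sup>2)))) \<longlonglongrightarrow> 0"
    by (simp only:)
  show ?thesis
  proof (rule tendsto_sandwich[OF _ _ tendsto_const lim'])
    show "\<forall>\<^sub>F j in sequentially. 0 \<le> 2 * pi * (ex41_M j + 1) * sqrt (2 * c\<^sup>2 / c ^ (2 ^ (j\<^sup>2)))"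
      using assms by (intro always_eventually allI) auto
    have "2 * pi * (ex41_M j + 1) \<le> 8 * pi * (2 ^ (j\<^sup>2)) ^ 3" for j
      using mult_left_mono[OF ex41_M_le[of j], of "2 * pi"] by (simp add: algebra_simps)
    then show "\<forall>\<^sub>F j in sequentially. 2 * pi * (ex41_M j + 1) * sqrt (2 * c\<^sup>2 / c ^ (2 ^ (j\<^sup>2)))
        \<le> 8 * pi * (2 ^ (j\<^sup>2)) ^ 3 * sqrt (2 * c\<^sup>2 / c ^ (2 ^ (j\<^sup>2)))"
      using assms by (intro always_eventually allI mult_right_mono) auto
  qed
qed

section \<open>Passage to almost every point\<close>

text \<open>A point where the ratio tends to 0 lies in all exceptional sets from some index on. Such
  a tail intersection sits inside sets of arbitrarily small measure, so it is null, and there are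
  countably many tails.\<close>

lemma AE_not_p_sq_over_K_Icc:
  fixes c b :: real
  assumes "1 < c" "c < b"
  shows "AE x in lborel. x \<in> {c..b} \<longrightarrow> \<not> (\<lambda>n. (ex41_p n x)\<^sup>2 / ex41_K n x x) \<longlonglongrightarrow> 0"
proof -
  define \<epsilon> where "\<epsilon> = (\<lambda>j. 2 * c\<^sup>2 / c ^ (2 ^ (j\<^sup>2)))"
  define B where "B = (\<lambda>j. {x \<in> {c..b}.
     (ex41_p (Suc (ex41_M j)) x - contr x * ex41_p (ex41_M j) x)\<^sup>2 \<le> \<epsilon> j * ex41_K (ex41_M j) x x})"
  have \<epsilon>: "\<epsilon> j > 0" for j using assms by (simp add: \<epsilon>_def)
  have B [measurable]: "B j \<in> sets borel" and
    B_le: "emeasure lborel (B j) \<le> ennreal (2 * pi * (ex41_M j + 1) * sqrt (\<epsilon> j))" for j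
    unfolding B_def by (rule near_contracting_measure[OF assms \<epsilon>])+
  have lim: "(\<lambda>j. ennreal (2 * pi * (ex41_M j + 1) * sqrt (\<epsilon> j))) \<longlonglongrightarrow> 0"
    using tendsto_ennrealI[OF exceptional_measure_tendsto_0[OF assms(1)]] by (simp add: \<epsilon>_def)
  have null: "(\<Inter>j\<in>{J..}. B j) \<in> null_sets lborel" for J
  proof -
    have meas: "(\<Inter>j\<in>{J..}. B j) \<in> sets lborel"
      by (intro sets.countable_INT') auto
    have "emeasure lborel (\<Inter>j\<in>{J..}. B j) \<le> ennreal (2 * pi * (ex41_M k + 1) * sqrt (\<epsilon> k))" if "k \<ge> J" for k
      using that by (intro order_trans[OF emeasure_mono B_le[of k]]) auto
    then have "emeasure lborel (\<Inter>j\<in>{J..}. B j) \<le> 0"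
      by (intro LIMSEQ_le_const[OF lim]) auto
    then show ?thesis using meas by auto
  qed
  show ?thesis
  proof (rule AE_I')
    show "(\<Union>J. \<Inter>j\<in>{J..}. B j) \<in> null_sets lborel"
      using null by blast
    show "{x \<in> space lborel. \<not> (x \<in> {c..b} \<longrightarrow> \<not> (\<lambda>n. (ex41_p n x)\<^sup>2 / ex41_K n x x) \<longlonglongrightarrow> 0)}
        \<subseteq> (\<Union>J. \<Inter>j\<in>{J..}. B j)"
    proof clarsimp
      fix x assume x: "c \<le> x" "x \<le> b" and lim: "(\<lambda>n. (ex41_p n x)\<^sup>2 / ex41_K n x x) \<longlonglongrightarrow> 0"
      have "1 - 1 / c > 0" using assms by simp
      from order_tendstoD(2)[OF lim this] obtain N where
        N: "\<And>n. n \<ge> N \<Longrightarrow> (ex41_p n x)\<^sup>2 / ex41_K n x x < 1 - 1 / c"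
        by (auto simp: eventually_sequentially)
      \<comment> \<open>\<open>Suc N\<close> ensures both \<open>j \<ge> 1\<close>, where the blocks
        begin, and \<open>ex41_M j \<ge> N\<close>.\<close>
      have "x \<in> B j" if "j \<ge> Suc N" for j
      proof -
        have "(ex41_p (Suc (ex41_M j)) x - contr x * ex41_p (ex41_M j) x)\<^sup>2
            \<le> 2 * c\<^sup>2 / c ^ (2 ^ (j\<^sup>2)) * ex41_K (ex41_M j) x x"
        proof (rule hyperbolic_block)
          fix n assume "n \<ge> ex41_M j"
          then have "n \<ge> N" using ex41_M_ge[of j] that by linarith
          then show "(ex41_p n x)\<^sup>2 \<le> (1 - 1 / c) * ex41_K n x x"
            using N[of n] ex41_K_pos[of n x] by (simp add: pos_divide_less_eq)
        qed (use assms x that ex41_a_C_block in auto)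
        then show ?thesis using x by (simp add: B_def \<epsilon>_def)
      qed
      then show "\<exists>J. \<forall>j\<in>{J..}. x \<in> B j" by auto
    qed
  qed
qed

lemma AE_not_p_sq_over_K:
  "AE x in lborel. 1 < x \<and> x \<le> 2 \<longrightarrow> \<not> (\<lambda>n. (ex41_p n x)\<^sup>2 / ex41_K n x x) \<longlonglongrightarrow> 0"
proof -
  \<comment> \<open>The growth rate degenerates at 1, so (1, 2] is exhausted by intervals bounded
    away from 1. The right end 3 keeps them nondegenerate for \<open>m = 0\<close>, whose left end
    is 2.\<close>
  have "AE x in lborel. \<forall>m::nat. x \<in> {1 + 1 / (real m + 1)..3} \<longrightarrow>
      \<not> (\<lambda>n. (ex41_p n x)\<^sup>2 / ex41_K n x x) \<longlonglongrightarrow> 0"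
    unfolding AE_all_countable by (intro allI AE_not_p_sq_over_K_Icc) (auto simp: field_simps)
  then show ?thesis
  proof eventually_elim
    case (elim x)
    show ?case
    proof (rule impI)
      assume x: "1 < x \<and> x \<le> 2"
      then obtain m :: nat where "inverse (real (Suc m)) < x - 1"
        using reals_Archimedean[of "x - 1"] by auto
      then have "x \<in> {1 + 1 / (real m + 1)..3}"
        using x by (auto simp: inverse_eq_divide add.commute)
      then show "\<not> (\<lambda>n. (ex41_p n x)\<^sup>2 / ex41_K n x x) \<longlonglongrightarrow> 0"
        using elim by blast
    qed
  qed
qed

theorem theorem4p2:
  fixes \<rho> :: "real measure"
  assumes "is_spectral_measure_ex41 \<rho>"
  shows "AE x0 in lborel. x0 \<in> {-2..2} - {-1..1} \<longrightarrow> \<not> nevai_at \<rho> x0"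
proof -
  \<comment> \<open>Reflection preserves Lebesgue measure, which carries the result to negative
    points.\<close>
  have "uminus \<in> lborel \<rightarrow>\<^sub>M (borel :: real measure)"
    by simp
  from AE_distrD[OF this, unfolded lborel_distr_uminus, OF AE_not_p_sq_over_K]
  have "AE x in lborel. 1 < - x \<and> - x \<le> 2 \<longrightarrow>
      \<not> (\<lambda>n. (ex41_p n (- x))\<^sup>2 / ex41_K n (- x) (- x)) \<longlonglongrightarrow> 0" .
  with AE_not_p_sq_over_K show ?thesis
  proof eventually_elim
    case (elim x)
    show ?case
    proof (intro impI notI)
      assume x: "x \<in> {-2..2} - {-1..1}" and "nevai_at \<rho> x"
      then have "(\<lambda>n. (ex41_p n x)\<^sup>2 / ex41_K n x x) \<longlonglongrightarrow> 0"
        by (intro nevai_imp_p_sq_over_K[OF assms]) auto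
      moreover have "1 < x \<and> x \<le> 2 \<or> 1 < - x \<and> - x \<le> 2"
        using x by auto
      ultimately show False
        using elim by (auto simp: ex41_p_minus_sq ex41_K_minus)
    qed
  qed
qed

end
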